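(* Let $\phi\colon\operatorname{Sym}^{++}(n)\to\mathbb R$ be a smooth scalar field. For every $\Sigma\in\operatorname{Sym}^{++}(n)$ and $V\in\operatorname{Sym}(n)$, the Riemannian Hessian of $\phi$ for the Wasserstein Riemannian metric satisfies $$\operatorname{Hess}\phi(\Sigma)(V,V)=\left\langle\nabla_V^2\phi(\Sigma)\,\Sigma+\Sigma\,\nabla_V^2\phi(\Sigma),V\right\rangle_\Sigma+\operatorname{Tr}\left[\nabla\phi(\Sigma)\,\mathcal L_\Sigma[V]\,\Sigma\,\mathcal L_\Sigma[V]\right].$$
   Context: $\operatorname{Sym}(n)$ is the space of real symmetric $n\times n$ matrices with inner product $\langle A,B\rangle_2=\frac12\operatorname{Tr}(AB)$; $\operatorname{Sym}^{++}(n)$ is the open cone of positive-definite ones. For $\Sigma\in\operatorname{Sym}^{++}(n)$ and $V\in\operatorname{Sym}(n)$, $\mathcal L_\Sigma[V]$ is the unique $X\in\operatorname{Sym}(n)$ with $X\Sigma+\Sigma X=V$. The Wasserstein Riemannian metric is $\langle U,V\rangle_\Sigma=W_\Sigma(U,V)=\operatorname{Tr}(\mathcal L_\Sigma[U]\Sigma\mathcal L_\Sigma[V])=\langle\mathcal L_\Sigma[U],V\rangle_2$, and $D$ is its Levi-Civita covariant derivative. $\nabla\phi$ is the gradient with respect to $\langle\cdot,\cdot\rangle_2$ and $\nabla_V^2\phi(\Sigma)=\nabla^2\phi(\Sigma)[V]$ is the ordinary derivative of $\nabla\phi$ at $\Sigma$ in the direction $V$. $\operatorname{grad}\phi$ is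 the gradient with respect to the Riemannian metric. The Riemannian Hessian is $\operatorname{Hess}_X\phi=D_X(\operatorname{grad}\phi)$, with associated symmetric bilinear form $\operatorname{Hess}\phi(\Sigma)(X,Y)=\langle D_X(\operatorname{grad}\phi)(\Sigma),Y\rangle_\Sigma$. *)

theory Defs
  imports "HOL-Analysis.Analysis"
begin

type_synonym 'n mat = "real ^ 'n ^ 'n"

definition Sym :: "'n::finite mat set" where
  "Sym = {A. transpose A = A}"

definition SPD :: "'n::finite mat set" where
  "SPD = {A \<in> Sym. \<forall>x. x \<noteq> 0 \<longrightarrow> x \<bullet> (A *v x) > 0}"

definition ip2 :: "'n::finite mat \<Rightarrow> 'n mat \<Rightarrow> real" where
  "ip2 A B = 1 / 2 * trace (A ** B)"

definition lyap :: "'n::finite mat \<Rightarrow> 'n mat \<Rightarrow> 'n mat" where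
  "lyap \<Sigma> V = (THE X. X \<in> Sym \<and> X ** \<Sigma> + \<Sigma> ** X = V)"

definition wass :: "'n::finite mat \<Rightarrow> 'n mat \<Rightarrow> 'n mat \<Rightarrow> real" where
  "wass \<Sigma> U V = trace (lyap \<Sigma> U ** \<Sigma> ** lyap \<Sigma> V)"


text \<open>
  \<^const>\<open>SPD\<close> is open in the subspace \<^const>\<open>Sym\<close>, but not in the space of all matrices.
  Calculus on it is therefore done with directions \<open>V \<in> Sym\<close> and derivatives within
  \<^const>\<open>SPD\<close>; functions on \<^const>\<open>SPD\<close> are total functions whose values elsewhere
  are irrelevant. For \<open>\<Sigma> \<in> SPD\<close> and \<open>V \<in> Sym\<close>, the point \<open>\<Sigma> + t V\<close> stays in
  \<^const>\<open>SPD\<close> for small \<open>t\<close>.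
\<close>

definition dir_deriv ::
    "('n::finite mat \<Rightarrow> 'b::real_normed_vector) \<Rightarrow> 'n mat \<Rightarrow> 'n mat \<Rightarrow> 'b" where
  "dir_deriv f \<Sigma> V = vector_derivative (\<lambda>t. f (\<Sigma> + t *\<^sub>R V)) (at 0)"

primrec Ck_SPD :: "nat \<Rightarrow> ('n::finite mat \<Rightarrow> 'b::real_normed_vector) \<Rightarrow> bool" where
  "Ck_SPD 0 f \<longleftrightarrow> continuous_on SPD f"
| "Ck_SPD (Suc k) f \<longleftrightarrow>
     (\<forall>\<Sigma>\<in>SPD. f differentiable (at \<Sigma> within SPD)) \<and>
     (\<forall>V\<in>Sym. Ck_SPD k (\<lambda>\<Sigma>. dir_deriv f \<Sigma> V))"

definition smooth_SPD :: "('n::finite mat \<Rightarrow> 'b::real_normed_vector) \<Rightarrow> bool" where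
  "smooth_SPD f \<longleftrightarrow> (\<forall>k. Ck_SPD k f)"

type_synonym 'n field = "'n mat \<Rightarrow> 'n mat"

definition vector_field :: "'n::finite field \<Rightarrow> bool" where
  "vector_field X \<longleftrightarrow> smooth_SPD X \<and> (\<forall>\<Sigma>\<in>SPD. X \<Sigma> \<in> Sym)"

definition lie_bracket :: "'n::finite field \<Rightarrow> 'n field \<Rightarrow> 'n field" where
  "lie_bracket X Y \<Sigma> = dir_deriv Y \<Sigma> (X \<Sigma>) - dir_deriv X \<Sigma> (Y \<Sigma>)"

definition affine_connection ::
    "('n::finite field \<Rightarrow> 'n field \<Rightarrow> 'n field) \<Rightarrow> bool" where
  "affine_connection D \<longleftrightarrow>
     (\<forall>X Y. vector_field X \<longrightarrow> vector_field Y \<longrightarrow> vector_field (D X Y)) \<and>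
     (\<forall>X X' Y. vector_field X \<longrightarrow> vector_field X' \<longrightarrow> vector_field Y \<longrightarrow>
        (\<forall>\<Sigma>\<in>SPD. D (\<lambda>S. X S + X' S) Y \<Sigma> = D X Y \<Sigma> + D X' Y \<Sigma>)) \<and>
     (\<forall>(f :: 'n mat \<Rightarrow> real) X Y. smooth_SPD f \<longrightarrow> vector_field X \<longrightarrow> vector_field Y \<longrightarrow>
        (\<forall>\<Sigma>\<in>SPD. D (\<lambda>S. f S *\<^sub>R X S) Y \<Sigma> = f \<Sigma> *\<^sub>R D X Y \<Sigma>)) \<and>
     (\<forall>X Y Y'. vector_field X \<longrightarrow> vector_field Y \<longrightarrow> vector_field Y' \<longrightarrow>
        (\<forall>\<Sigma>\<in>SPD. D X (\<lambda>S. Y S + Y' S) \<Sigma> = D X Y \<Sigma> + D X Y' \<Sigma>)) \<and>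
     (\<forall>(f :: 'n mat \<Rightarrow> real) X Y. smooth_SPD f \<longrightarrow> vector_field X \<longrightarrow> vector_field Y \<longrightarrow>
        (\<forall>\<Sigma>\<in>SPD. D X (\<lambda>S. f S *\<^sub>R Y S) \<Sigma> =
           dir_deriv f \<Sigma> (X \<Sigma>) *\<^sub>R Y \<Sigma> + f \<Sigma> *\<^sub>R D X Y \<Sigma>))"

definition torsion_free ::
    "('n::finite field \<Rightarrow> 'n field \<Rightarrow> 'n field) \<Rightarrow> bool" where
  "torsion_free D \<longleftrightarrow>
     (\<forall>X Y. vector_field X \<longrightarrow> vector_field Y \<longrightarrow>
        (\<forall>\<Sigma>\<in>SPD. D X Y \<Sigma> - D Y X \<Sigma> = lie_bracket X Y \<Sigma>))"

definition metric_compatible ::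
    "('n::finite field \<Rightarrow> 'n field \<Rightarrow> 'n field) \<Rightarrow> bool" where
  "metric_compatible D \<longleftrightarrow>
     (\<forall>X Y Z. vector_field X \<longrightarrow> vector_field Y \<longrightarrow> vector_field Z \<longrightarrow>
        (\<forall>\<Sigma>\<in>SPD. dir_deriv (\<lambda>S. wass S (Y S) (Z S)) \<Sigma> (X \<Sigma>) =
           wass \<Sigma> (D X Y \<Sigma>) (Z \<Sigma>) + wass \<Sigma> (Y \<Sigma>) (D X Z \<Sigma>)))"

definition levi_civita ::
    "('n::finite field \<Rightarrow> 'n field \<Rightarrow> 'n field) \<Rightarrow> bool" where
  "levi_civita D \<longleftrightarrow> affine_connection D \<and> torsion_free D \<and> metric_compatible D"

text \<open>
  A connection is tensorial in its first argument, so \<open>D X Y\<close> at \<open>\<Sigma>\<close> is the same for all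
  vector fields \<open>X\<close> with the given tangent vector \<open>U\<close> as value at \<open>\<Sigma>\<close>.
\<close>

definition cov_deriv_at ::
    "('n::finite field \<Rightarrow> 'n field \<Rightarrow> 'n field) \<Rightarrow> 'n mat \<Rightarrow> 'n mat \<Rightarrow> 'n field \<Rightarrow> 'n mat" where
  "cov_deriv_at D \<Sigma> U Y =
     (THE W. \<forall>X. vector_field X \<longrightarrow> X \<Sigma> = U \<longrightarrow> D X Y \<Sigma> = W)"


definition gradient_wrt ::
    "('n::finite mat \<Rightarrow> 'n mat \<Rightarrow> real) \<Rightarrow> ('n mat \<Rightarrow> real) \<Rightarrow> 'n mat \<Rightarrow> 'n mat" where
  "gradient_wrt g \<phi> \<Sigma> = (THE G. G \<in> Sym \<and> (\<forall>V\<in>Sym. g G V = dir_deriv \<phi> \<Sigma> V))"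

definition nabla :: "('n::finite mat \<Rightarrow> real) \<Rightarrow> 'n field" where
  "nabla \<phi> \<Sigma> = gradient_wrt ip2 \<phi> \<Sigma>"

definition nabla2 :: "('n::finite mat \<Rightarrow> real) \<Rightarrow> 'n mat \<Rightarrow> 'n mat \<Rightarrow> 'n mat" where
  "nabla2 \<phi> \<Sigma> V = dir_deriv (nabla \<phi>) \<Sigma> V"

definition riem_grad :: "('n::finite mat \<Rightarrow> real) \<Rightarrow> 'n field" where
  "riem_grad \<phi> \<Sigma> = gradient_wrt (wass \<Sigma>) \<phi> \<Sigma>"

definition riem_hess ::
    "('n::finite field \<Rightarrow> 'n field \<Rightarrow> 'n field) \<Rightarrow> ('n mat \<Rightarrow> real) \<Rightarrow>
      'n mat \<Rightarrow> 'n mat \<Rightarrow> 'n mat \<Rightarrow> real" where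
  "riem_hess D \<phi> \<Sigma> U V = wass \<Sigma> (cov_deriv_at D \<Sigma> U (riem_grad \<phi>)) V"

end

theory Submission
  imports Defs
begin

text \<open>
  The Hessian is computed with constant vector fields only. Write \<open>A\<close> for the Euclidean gradient
  \<open>nabla \<phi> \<Sigma>\<close> and \<open>L = lyap \<Sigma> V\<close>. The metric is \<open>wass \<Sigma> U V = ip2 (lyap \<Sigma> U) V\<close>, so the
  Riemannian gradient is \<open>G = A \<Sigma> + \<Sigma> A\<close> (\<open>riem_grad_eq\<close>). Metric compatibility applied to the
  gradient and the constant field \<open>V\<close> gives

  \<open>Hess \<phi> \<Sigma> V V = V (wass (grad \<phi>) V) - wass (grad \<phi>) (D V V)\<close>.

  In the first term \<open>wass (grad \<phi>) V = ip2 (nabla \<phi>) V\<close>, whose derivative along \<open>V\<close> is the Euclidean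
  Hessian \<open>ip2 H V = wass \<Sigma> (H \<Sigma> + \<Sigma> H) V\<close> with \<open>H = nabla2 \<phi> \<Sigma> V\<close>. The second term is a Christoffel
  term, and Koszul's formula for constant fields (\<open>koszul_const\<close>) expresses it by directional
  derivatives of the metric coefficients, that is, of \<^const>\<open>lyap\<close>. Differentiating the Lyapunov
  equation gives the derivative \<open>- lyap \<Sigma> (L U + U L)\<close> of \<open>lyap \<Sigma> V\<close> in the direction \<open>U\<close>
  (\<open>lyap_line_derivative\<close>), and after substitution everything cancels except the trace of \<open>A L \<Sigma> L\<close>
  (\<open>wass_christoffel\<close>).

  Two points need work beyond this computation. The covariant derivative at a point is defined by
  all fields with a given value there, so the connection must be shown to be tensorial
  (\<open>affine_connection_frame\<close>); and the Riemannian gradient must be a smooth field before a connection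
  applies to it, which is derived from closure of smoothness under derivatives, sums and bilinear
  products (\<open>vector_field_riem_grad\<close>).
\<close>

section \<open>The trace form on matrices\<close>

lemma inner_matrix_eq_trace:
  fixes A B :: "'n::finite mat"
  shows "A \<bullet> B = trace (transpose A ** B)"
  by (simp add: inner_vec_def trace_def matrix_matrix_mult_def transpose_def) (rule sum.swap)

lemma inner_matrix_mult_left:
  fixes A B C :: "'n::finite mat"
  shows "(A ** B) \<bullet> C = B \<bullet> (transpose A ** C)"
  by (simp add: inner_matrix_eq_trace matrix_transpose_mul matrix_mul_assoc)

lemma inner_transpose:
  fixes A B :: "'n::finite mat"
  shows "transpose A \<bullet> B = A \<bullet> transpose B"
  by (simp add: inner_vec_def transpose_def) (rule sum.swap)

lemma inner_matrix_mult_right: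
  fixes A B C :: "'n::finite mat"
  shows "(A ** B) \<bullet> C = A \<bullet> (C ** transpose B)"
proof -
  have "(A ** B) \<bullet> C = (transpose B ** transpose A) \<bullet> transpose C"
    using inner_transpose[of "A ** B" "transpose C"] by (simp add: matrix_transpose_mul)
  also have "\<dots> = transpose A \<bullet> (B ** transpose C)"
    by (simp add: inner_matrix_mult_left)
  also have "\<dots> = A \<bullet> (C ** transpose B)"
    by (simp add: inner_transpose matrix_transpose_mul)
  finally show ?thesis .
qed

lemma bounded_bilinear_matrix_mult:
  "bounded_bilinear ((**) :: 'n::finite mat \<Rightarrow> 'n mat \<Rightarrow> 'n mat)"
  unfolding bilinear_conv_bounded_bilinear[symmetric] bilinear_def
  by (auto intro!: linearI simp: matrix_matrix_mult_def vec_eq_iff sum.distrib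
      sum_distrib_left algebra_simps)

lemmas matrix_mult_simps = matrix_mul_assoc
  bounded_bilinear.add_left[OF bounded_bilinear_matrix_mult]
  bounded_bilinear.add_right[OF bounded_bilinear_matrix_mult]
  bounded_bilinear.diff_left[OF bounded_bilinear_matrix_mult]
  bounded_bilinear.diff_right[OF bounded_bilinear_matrix_mult]
  bounded_bilinear.scaleR_left[OF bounded_bilinear_matrix_mult]
  bounded_bilinear.scaleR_right[OF bounded_bilinear_matrix_mult]
  bounded_bilinear.minus_left[OF bounded_bilinear_matrix_mult]
  bounded_bilinear.minus_right[OF bounded_bilinear_matrix_mult]

lemma bounded_linear_transpose: "bounded_linear (transpose :: 'n::finite mat \<Rightarrow> 'n mat)"
  unfolding linear_conv_bounded_linear[symmetric]
  by (auto intro!: linearI simp: transpose_def vec_eq_iff)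

section \<open>Positive-definite matrices\<close>

lemma SymD: "A \<in> Sym \<Longrightarrow> transpose A = A"
  by (simp add: Sym_def)

lemma subspace_Sym: "subspace (Sym :: 'n::finite mat set)"
  unfolding subspace_def Sym_def
  by (simp add: linear_simps[OF bounded_linear_transpose] transpose_scalar)

lemma Sym_anticommutator:
  assumes "A \<in> Sym" "B \<in> Sym"
  shows "A ** B + B ** A \<in> Sym"
  using assms by (simp add: Sym_def linear_simps[OF bounded_linear_transpose] matrix_transpose_mul add.commute)

lemma SPD_Sym: "S \<in> SPD \<Longrightarrow> S \<in> Sym"
  by (simp add: SPD_def)

lemma ip2_eq_inner: "A \<in> Sym \<Longrightarrow> ip2 A B = (A \<bullet> B) / 2"
  by (simp add: ip2_def inner_matrix_eq_trace SymD)

lemma SPD_coercive: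
  fixes S :: "'n::finite mat"
  assumes "S \<in> SPD"
  obtains c where "c > 0" "\<And>x. c * (norm x)\<^sup>2 \<le> x \<bullet> (S *v x)"
proof -
  \<comment> \<open>The constant is the minimum of the quadratic form on the unit sphere.\<close>
  let ?q = "\<lambda>x::real^'n. x \<bullet> (S *v x)"
  have "continuous_on (sphere 0 1) ?q"
    by (intro continuous_intros linear_continuous_on matrix_vector_mul_bounded_linear)
  moreover have "sphere (0::real^'n) 1 \<noteq> {}" by simp
  ultimately obtain u where u: "u \<in> sphere 0 1" "\<And>x. x \<in> sphere 0 1 \<Longrightarrow> ?q u \<le> ?q x"
    using continuous_attains_inf[of "sphere 0 1" ?q] by auto
  show ?thesis
  proof
    have "u \<noteq> 0" using u(1) by auto
    then show "?q u > 0" using assms by (simp add: SPD_def)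
    fix x
    show "?q u * (norm x)\<^sup>2 \<le> ?q x"
    proof (cases "x = 0")
      case False
      have "?q u \<le> ?q ((1 / norm x) *\<^sub>R x)" using False by (intro u(2)) simp
      also have "\<dots> = ?q x / (norm x)\<^sup>2"
        by (simp add: matrix_vector_mult_scaleR power2_eq_square)
      finally show ?thesis using False by (simp add: field_simps)
    qed simp
  qed
qed

text \<open>
  Openness of \<^const>\<open>SPD\<close> in \<^const>\<open>Sym\<close> along a line, together with a coercivity constant that
  serves for the whole segment.
\<close>

lemma SPD_line_uniform:
  fixes S V :: "'n::finite mat"
  assumes "S \<in> SPD" "V \<in> Sym"
  obtains c e where "c > 0" "e > 0" "\<And>t. \<bar>t\<bar> < e \<Longrightarrow> S + t *\<^sub>R V \<in> SPD"
    "\<And>t x. \<bar>t\<bar> < e \<Longrightarrow> c * (norm x)\<^sup>2 \<le> x \<bullet> ((S + t *\<^sub>R V) *v x)"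
proof -
  obtain c where c: "c > 0" "\<And>x. c * (norm x)\<^sup>2 \<le> x \<bullet> (S *v x)"
    using SPD_coercive[OF assms(1)] by blast
  obtain K where K: "K > 0" "\<And>x. norm (V *v x) \<le> norm x * K"
    using bounded_linear.pos_bounded[OF matrix_vector_mul_bounded_linear[of V]] by blast
  have bound: "(c/2) * (norm x)\<^sup>2 \<le> x \<bullet> ((S + t *\<^sub>R V) *v x)" if t: "\<bar>t\<bar> < c / (2*K)" for t x
  proof -
    have "\<bar>x \<bullet> (V *v x)\<bar> \<le> norm x * (norm x * K)"
      using Cauchy_Schwarz_ineq2[of x "V *v x"] K(2)[of x]
      by (meson mult_left_mono norm_ge_zero order_trans)
    then have "\<bar>t\<bar> * \<bar>x \<bullet> (V *v x)\<bar> \<le> (c / (2*K)) * (norm x * (norm x * K))"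
      using t by (intro mult_mono) auto
    also have "\<dots> = (c/2) * (norm x)\<^sup>2" using K(1) by (simp add: power2_eq_square)
    finally have "\<bar>t * (x \<bullet> (V *v x))\<bar> \<le> (c/2) * (norm x)\<^sup>2" by (simp add: abs_mult)
    moreover have "x \<bullet> ((S + t *\<^sub>R V) *v x) = x \<bullet> (S *v x) + t * (x \<bullet> (V *v x))"
      by (simp add: matrix_vector_mult_add_rdistrib scaleR_matrix_vector_assoc[symmetric] inner_right_distrib)
    ultimately show ?thesis using c(2)[of x] by linarith
  qed
  show ?thesis
  proof
    show "c/2 > 0" "c/(2*K) > 0" using c K by auto
    show "(c/2) * (norm x)\<^sup>2 \<le> x \<bullet> ((S + t *\<^sub>R V) *v x)" if "\<bar>t\<bar> < c/(2*K)" for t x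
      using bound[OF that] .
    show "S + t *\<^sub>R V \<in> SPD" if t: "\<bar>t\<bar> < c/(2*K)" for t
      unfolding SPD_def
    proof (intro CollectI conjI allI impI)
      show "S + t *\<^sub>R V \<in> Sym"
        by (intro subspace_add[OF subspace_Sym] subspace_scale[OF subspace_Sym] SPD_Sym assms)
      fix x :: "real^'n" assume "x \<noteq> 0"
      then have "0 < (c/2) * (norm x)\<^sup>2" using c by simp
      then show "0 < x \<bullet> ((S + t *\<^sub>R V) *v x)" using bound[OF t, of x] by linarith
    qed
  qed
qed

section \<open>The Lyapunov operator and the metric\<close>

text \<open>
  Testing the equation \<open>X ** S + S ** X = V\<close> against \<open>X\<close> turns coercivity of \<open>S\<close> into
  coercivity of the Lyapunov operator \<open>X \<mapsto> X ** S + S ** X\<close> with twice the constant: one term sums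
  the quadratic form of \<open>S\<close> over the rows of \<open>X\<close>, the other one over its columns.
\<close>

lemma coercive_lyapunov:
  fixes S X :: "'n::finite mat"
  assumes S: "S \<in> Sym" and c: "\<And>x. c * (norm x)\<^sup>2 \<le> x \<bullet> (S *v x)"
  shows "2 * c * (norm X)\<^sup>2 \<le> X \<bullet> (X ** S + S ** X)"
proof -
  have right: "c * (norm Y)\<^sup>2 \<le> Y \<bullet> (Y ** S)" for Y :: "'n mat"
  proof -
    have row: "(Y ** S) $ i = S *v (Y $ i)" for i
      using SymD[OF S] unfolding matrix_matrix_mult_def matrix_vector_mult_def vec_eq_iff transpose_def
      by (simp add: mult.commute) 
    have "c * (norm Y)\<^sup>2 = (\<Sum>i\<in>UNIV. c * (norm (Y $ i))\<^sup>2)"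
      by (simp add: power2_norm_eq_inner inner_vec_def sum_distrib_left)
    also have "\<dots> \<le> (\<Sum>i\<in>UNIV. (Y $ i) \<bullet> (S *v (Y $ i)))"
      by (intro sum_mono c)
    also have "\<dots> = Y \<bullet> (Y ** S)" unfolding inner_vec_def[of Y] row ..
    finally show ?thesis .
  qed
  have "norm (transpose X) = norm X" 
    by (simp add: norm_eq_sqrt_inner inner_transpose)
  moreover have "transpose X \<bullet> (transpose X ** S) = X \<bullet> (S ** X)"
    by (simp add: inner_transpose matrix_transpose_mul SymD[OF S])
  ultimately show ?thesis using right[of X] right[of "transpose X"] by (simp add: inner_right_distrib)
qed

text \<open>
  Read for a single \<open>S\<close>, this estimate is injectivity of the Lyapunov operator. Read for all \<open>S\<close> on
  a short segment, with one constant \<open>c\<close>, it bounds the inverse operators uniformly, which is what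
  makes \<^const>\<open>lyap\<close> differentiable along the segment.
\<close>

lemma norm_le_lyapunov:
  fixes S X :: "'n::finite mat"
  assumes "S \<in> Sym" and "\<And>x. c * (norm x)\<^sup>2 \<le> x \<bullet> (S *v x)"
  shows "2 * c * norm X \<le> norm (X ** S + S ** X)"
proof (cases "X = 0")
  case False
  have "2 * c * (norm X)\<^sup>2 \<le> norm X * norm (X ** S + S ** X)"
    using coercive_lyapunov[OF assms, of X] norm_cauchy_schwarz order_trans by blast
  then show ?thesis using False by (simp add: power2_eq_square)
qed simp

text \<open>
  The Lyapunov operator is considered on all matrices, where injectivity gives surjectivity by
  dimension; the solution for a symmetric right-hand side is symmetric because its transpose
  solves the same equation. Uniqueness therefore holds among all matrices.
\<close>

lemma
  fixes S V :: "'n::finite mat"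
  assumes S: "S \<in> SPD" and V: "V \<in> Sym"
  shows lyap_Sym: "lyap S V \<in> Sym" and lyap_eq: "lyap S V ** S + S ** lyap S V = V"
    and lyap_unique: "\<And>X. X ** S + S ** X = V \<Longrightarrow> lyap S V = X"
proof -
  obtain c where c: "c > 0" "\<And>x. c * (norm x)\<^sup>2 \<le> x \<bullet> (S *v x)"
    using SPD_coercive[OF S] by blast
  let ?T = "\<lambda>X::'n mat. X ** S + S ** X"
  have lin: "linear ?T" by (intro linearI) (simp_all add: matrix_mult_simps scaleR_right_distrib)
  have zero: "X = 0" if "?T X = 0" for X
    using norm_le_lyapunov[OF SPD_Sym[OF S] c(2), of X] that c(1) by (simp add: mult_le_0_iff)
  have inj: "inj ?T" unfolding linear_injective_0[OF lin] using zero by blast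
  obtain X where X: "?T X = V"
    using surjD[OF linear_injective_imp_surjective[OF lin inj], of V] by (auto dest: sym)
  have "?T (transpose X) = transpose (?T X)"
    by (simp add: linear_simps[OF bounded_linear_transpose] matrix_transpose_mul SymD SPD_Sym S add.commute)
  then have "?T (transpose X) = ?T X" using X V by (simp add: SymD)
  then have XS: "X \<in> Sym" using injD[OF inj] unfolding Sym_def by blast
  have eq: "lyap S V = Y" if "?T Y = V" for Y
  proof -
    have "Y = X" using injD[OF inj, of Y X] that X by metis
    then show ?thesis unfolding lyap_def
      using XS X injD[OF inj] by (intro the_equality) (metis+)
  qed
  show "lyap S V \<in> Sym" "?T (lyap S V) = V" using eq[OF X] X XS by auto
  show "\<And>X. ?T X = V \<Longrightarrow> lyap S V = X" by (rule eq)
qed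

lemma lyap_self_adjoint:
  assumes "S \<in> SPD" "U \<in> Sym" "V \<in> Sym"
  shows "lyap S U \<bullet> V = U \<bullet> lyap S V"
proof -
  let ?A = "lyap S U" and ?B = "lyap S V"
  have "?A \<bullet> (?B ** S + S ** ?B) = (?A ** S + S ** ?A) \<bullet> ?B"
    by (simp add: inner_left_distrib inner_right_distrib inner_matrix_mult_left[of S ?A]
        inner_matrix_mult_right[of ?A S] SymD SPD_Sym assms)
  then show ?thesis by (simp add: lyap_eq assms)
qed

lemma wass_eq_inner:
  assumes "S \<in> SPD" "U \<in> Sym" "V \<in> Sym"
  shows "wass S U V = (lyap S U \<bullet> V) / 2"
proof -
  let ?A = "lyap S U" and ?B = "lyap S V"
  have s: "?A \<in> Sym" "?B \<in> Sym" "S \<in> Sym" using assms by (auto intro: lyap_Sym SPD_Sym)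
  have "?A \<bullet> (?B ** S) = transpose ?A \<bullet> (?B ** S)" using s by (simp add: SymD)
  also have "\<dots> = ?A \<bullet> (S ** ?B)" unfolding inner_transpose using s by (simp add: matrix_transpose_mul SymD)
  finally have "?A \<bullet> (?B ** S + S ** ?B) = 2 * (?A \<bullet> (S ** ?B))"
    by (simp add: inner_right_distrib)
  moreover have "wass S U V = ?A \<bullet> (S ** ?B)"
    using s by (simp add: wass_def inner_matrix_eq_trace SymD matrix_mul_assoc)
  ultimately show ?thesis by (simp add: lyap_eq assms)
qed

lemma wass_commute:
  assumes "S \<in> SPD" "U \<in> Sym" "V \<in> Sym"
  shows "wass S U V = wass S V U"
proof -
  have "wass S U V = (U \<bullet> lyap S V) / 2"
    by (simp only: wass_eq_inner[OF assms] lyap_self_adjoint[OF assms])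
  also have "\<dots> = wass S V U"
    by (simp only: wass_eq_inner[OF assms(1,3,2)] inner_commute)
  finally show ?thesis .
qed

text \<open>
  With \<open>L = lyap S V\<close>, subtracting the equations for \<open>lyap (S + t U) V\<close> and \<open>L\<close> shows that their
  difference is exactly \<open>- t\<close> times \<open>lyap (S + t U) (L U + U L)\<close>. So the difference quotient converges
  once \<open>t \<mapsto> lyap (S + t U) P\<close> is continuous at \<open>0\<close> for each symmetric \<open>P\<close>; the same identity,
  applied to \<open>P\<close>, reduces that to the uniform bound on \<^const>\<open>lyap\<close>.
\<close>

lemma lyap_line_derivative:
  fixes S U V :: "'n::finite mat"
  assumes S: "S \<in> SPD" and U: "U \<in> Sym" and V: "V \<in> Sym"
  shows "((\<lambda>t. lyap (S + t *\<^sub>R U) V) has_vector_derivative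
           - lyap S (lyap S V ** U + U ** lyap S V)) (at 0)"
proof -
  obtain c e where ce: "c > 0" "e > 0" and spd: "\<And>t. \<bar>t\<bar> < e \<Longrightarrow> S + t *\<^sub>R U \<in> SPD"
    and co: "\<And>t x. \<bar>t\<bar> < e \<Longrightarrow> c * (norm x)\<^sup>2 \<le> x \<bullet> ((S + t *\<^sub>R U) *v x)"
    using SPD_line_uniform[OF S U] by blast
  let ?S = "\<lambda>t. S + t *\<^sub>R U"
  have diff: "lyap (?S t) W - lyap S W = - t *\<^sub>R lyap (?S t) (lyap S W ** U + U ** lyap S W)"
    if t: "\<bar>t\<bar> < e" and W: "W \<in> Sym" for t W
  proof -
    let ?P = "lyap S W ** U + U ** lyap S W"
    have P: "?P \<in> Sym" by (intro Sym_anticommutator lyap_Sym S W U)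
    \<comment> \<open>The claimed value solves the Lyapunov equation at the displaced point.\<close>
    let ?Y = "lyap S W - t *\<^sub>R lyap (?S t) ?P"
    have "?Y ** ?S t + ?S t ** ?Y
        = (lyap S W ** ?S t + ?S t ** lyap S W)
          - t *\<^sub>R (lyap (?S t) ?P ** ?S t + ?S t ** lyap (?S t) ?P)"
      unfolding bounded_bilinear.diff_left[OF bounded_bilinear_matrix_mult]
         bounded_bilinear.diff_right[OF bounded_bilinear_matrix_mult]
         bounded_bilinear.scaleR_left[OF bounded_bilinear_matrix_mult]
         bounded_bilinear.scaleR_right[OF bounded_bilinear_matrix_mult]
      by (simp add: algebra_simps)
    also have "\<dots> = (lyap S W ** ?S t + ?S t ** lyap S W) - t *\<^sub>R ?P"
      by (simp only: lyap_eq[OF spd[OF t] P])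
    also have "\<dots> = lyap S W ** S + S ** lyap S W" by (simp add: matrix_mult_simps algebra_simps)
    also have "\<dots> = W" by (rule lyap_eq[OF S W])
    finally have "lyap (?S t) W = ?Y" by (rule lyap_unique[OF spd[OF t] W])
    then show ?thesis by simp
  qed
  have bnd: "norm (lyap (?S t) W) \<le> norm W / (2*c)" if t: "\<bar>t\<bar> < e" and W: "W \<in> Sym" for t W
    using norm_le_lyapunov[OF SPD_Sym[OF spd[OF t]] co[OF t], of "lyap (?S t) W"]
    unfolding lyap_eq[OF spd[OF t] W] using ce(1) by (simp add: field_simps)
  have near: "eventually (\<lambda>t::real. \<bar>t\<bar> < e) (at 0)"
    using eventually_at_in_open'[of "ball 0 e" 0] ce(2) by (auto simp: dist_real_def elim: eventually_mono)
  define P where "P = lyap S V ** U + U ** lyap S V"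
  define Q where "Q = lyap S P ** U + U ** lyap S P"
  have P: "P \<in> Sym" unfolding P_def by (intro Sym_anticommutator lyap_Sym S V U)
  have Q: "Q \<in> Sym" unfolding Q_def by (intro Sym_anticommutator lyap_Sym S P U)
  have "((\<lambda>t. lyap (?S t) P - lyap S P) \<longlongrightarrow> 0) (at 0)"
  proof (rule Lim_null_comparison)
    show "\<forall>\<^sub>F t in at 0. norm (lyap (?S t) P - lyap S P) \<le> \<bar>t\<bar> * (norm Q / (2*c))"
      using near
    proof (rule eventually_mono)
      fix t :: real assume t: "\<bar>t\<bar> < e"
      show "norm (lyap (?S t) P - lyap S P) \<le> \<bar>t\<bar> * (norm Q / (2*c))"
        unfolding diff[OF t P] Q_def[symmetric] using bnd[OF t Q] ce(1)
        by (simp add: mult_left_mono del: times_divide_eq_right)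
    qed
    show "((\<lambda>t. \<bar>t\<bar> * (norm Q / (2*c))) \<longlongrightarrow> 0) (at 0)"
      using ce(1) by (auto intro!: tendsto_eq_intros)
  qed
  then have lim: "((\<lambda>t. - lyap (?S t) P) \<longlongrightarrow> - lyap S P) (at 0)"
    by (simp add: LIM_zero_iff tendsto_minus_cancel_left)
  have "((\<lambda>t. (1/t) *\<^sub>R (lyap (?S t) V - lyap S V)) \<longlongrightarrow> - lyap S P) (at 0)"
  proof (rule Lim_transform_eventually[OF lim])
    show "\<forall>\<^sub>F t in at 0. - lyap (?S t) P = (1/t) *\<^sub>R (lyap (?S t) V - lyap S V)"
      using near eventually_neq_at_within[of 0 0 UNIV]
    proof eventually_elim
      case (elim t)
      then show ?case unfolding diff[OF elim(1) V] P_def[symmetric] by simp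
    qed
  qed
  then have "((\<lambda>t. norm ((1/t) *\<^sub>R (lyap (?S t) V - lyap S V) - (- lyap S P))) \<longlongrightarrow> 0) (at 0)"
    by (intro tendsto_norm_zero LIM_zero)
  then have "((\<lambda>t. norm (lyap (?S t) V - lyap S V - t *\<^sub>R (- lyap S P)) / norm t) \<longlongrightarrow> 0) (at 0)"
  proof (rule Lim_transform_eventually)
    show "\<forall>\<^sub>F t in at 0. norm ((1/t) *\<^sub>R (lyap (?S t) V - lyap S V) - (- lyap S P))
        = norm (lyap (?S t) V - lyap S V - t *\<^sub>R (- lyap S P)) / norm t"
      using eventually_neq_at_within[of 0 0 UNIV]
    proof eventually_elim
      case (elim t)
      have "(1/t) *\<^sub>R (lyap (?S t) V - lyap S V) - (- lyap S P)
          = (1/t) *\<^sub>R (lyap (?S t) V - lyap S V - t *\<^sub>R (- lyap S P))"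
        using elim by (simp add: scaleR_right_diff_distrib scaleR_right_distrib)
      then show ?case by (simp add: divide_inverse mult.commute)
    qed
  qed
  then show ?thesis unfolding P_def[symmetric]
    by (simp add: has_vector_derivative_def has_derivative_at bounded_linear_scaleR_left bounded_linear_minus)
qed


section \<open>Calculus on the cone\<close>

lemma eventually_line_SPD:
  fixes S V :: "'n::finite mat"
  assumes "S \<in> SPD" "V \<in> Sym"
  shows "eventually (\<lambda>t. S + t *\<^sub>R V \<in> SPD) (nhds 0)"
proof -
  obtain e where "e > 0" "\<And>t. \<bar>t\<bar> < e \<Longrightarrow> S + t *\<^sub>R V \<in> SPD"
    using SPD_line_uniform[OF assms] by metis
  then show ?thesis unfolding eventually_nhds_metric by (auto simp: dist_real_def)
qed

lemma dir_deriv_eqI: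
  "((\<lambda>t. f (S + t *\<^sub>R V)) has_vector_derivative d) (at 0) \<Longrightarrow> dir_deriv f S V = d"
  unfolding dir_deriv_def by (rule vector_derivative_at)

lemma dir_deriv_cong:
  assumes "S \<in> SPD" "V \<in> Sym" and "\<And>S. S \<in> SPD \<Longrightarrow> f S = g S"
  shows "dir_deriv f S V = dir_deriv g S V"
  unfolding dir_deriv_def
  using eventually_line_SPD[OF assms(1,2)] assms(3)
  by (intro vector_derivative_cong_eq) (auto elim: eventually_mono)

lemma line_vector_derivative:
  assumes "(f has_derivative f') (at S within SPD)" "S \<in> SPD" "V \<in> Sym"
  shows "((\<lambda>t. f (S + t *\<^sub>R V)) has_vector_derivative f' V) (at 0)"
proof -
  obtain T where T: "open T" "0 \<in> T" "\<And>t. t \<in> T \<Longrightarrow> S + t *\<^sub>R V \<in> SPD"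
    using eventually_line_SPD[OF assms(2,3)] unfolding eventually_nhds by blast
  have "((\<lambda>t. f (S + t *\<^sub>R V)) has_derivative (\<lambda>h. f' (h *\<^sub>R V))) (at 0 within T)"
  proof (rule has_derivative_in_compose[where f = "\<lambda>t. S + t *\<^sub>R V" and g = f and g' = f'
        and f' = "\<lambda>h. h *\<^sub>R V"])
    show "((\<lambda>t. S + t *\<^sub>R V) has_derivative (\<lambda>h. h *\<^sub>R V)) (at 0 within T)"
      by (auto intro!: derivative_eq_intros)
    show "(f has_derivative f') (at (S + 0 *\<^sub>R V) within (\<lambda>t. S + t *\<^sub>R V) ` T)"
      using assms(1) T by (auto intro: has_derivative_subset)
  qed
  moreover have "f' (h *\<^sub>R V) = h *\<^sub>R f' V" for h
    by (rule linear_cmul[OF has_derivative_linear[OF assms(1)]])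
  ultimately show ?thesis
    using at_within_open[OF T(2,1)] by (simp add: has_vector_derivative_def)
qed

lemma dir_deriv_eq:
  assumes "(f has_derivative f') (at S within SPD)" "S \<in> SPD" "V \<in> Sym"
  shows "dir_deriv f S V = f' V"
  by (rule dir_deriv_eqI[OF line_vector_derivative[OF assms]])

text \<open>
  Fields given by a definite description are controlled only on \<^const>\<open>SPD\<close>, so smoothness must be
  transported from an explicit formula that agrees with them there.
\<close>

lemma Ck_SPD_cong:
  assumes "Ck_SPD k f" and "\<And>S. S \<in> SPD \<Longrightarrow> f S = g S"
  shows "Ck_SPD k g"
  using assms
proof (induction k arbitrary: f g)
  case 0
  then show ?case using continuous_on_cong[of SPD SPD f g] by simp
next
  case (Suc k)
  have "g differentiable (at S within SPD)" if "S \<in> SPD" for S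
    using Suc.prems that by (intro differentiable_transform_within[of f S SPD 1 g]) auto
  moreover have "Ck_SPD k (\<lambda>S. dir_deriv g S V)" if "V \<in> Sym" for V
  proof (rule Suc.IH)
    show "Ck_SPD k (\<lambda>S. dir_deriv f S V)" using Suc.prems(1) that by simp
    show "dir_deriv f S V = dir_deriv g S V" if "S \<in> SPD" for S
      using that \<open>V \<in> Sym\<close> Suc.prems(2) by (rule dir_deriv_cong)
  qed
  ultimately show ?case by simp
qed

lemma Ck_SPD_Suc: "Ck_SPD (Suc k) f \<Longrightarrow> Ck_SPD k f"
proof (induction k arbitrary: f)
  case 0
  then show ?case
    by (auto simp: continuous_on_eq_continuous_within intro: differentiable_imp_continuous_within)
next
  case (Suc k)
  then have "\<forall>V\<in>Sym. Ck_SPD k (\<lambda>S. dir_deriv f S V)" by (metis Ck_SPD.simps(2))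
  moreover have "\<forall>S\<in>SPD. f differentiable (at S within SPD)" using Suc.prems by simp
  ultimately show ?case by simp
qed

lemma dir_deriv_const [simp]: "dir_deriv (\<lambda>_. c) S V = 0"
  by (rule dir_deriv_eqI) simp

lemma Ck_SPD_const: "Ck_SPD k (\<lambda>_. c)"
  by (induction k arbitrary: c) auto

lemma Ck_SPD_id: "Ck_SPD k (\<lambda>S. S)"
proof (cases k)
  case (Suc m)
  have "dir_deriv (\<lambda>S. S) S V = V" for S V :: "'a mat"
    by (rule dir_deriv_eqI) (auto intro!: derivative_eq_intros simp: has_vector_derivative_def)
  then show ?thesis using Suc by (simp add: Ck_SPD_const)
qed simp

lemma Ck_SPD_add:
  assumes "Ck_SPD k f" "Ck_SPD k g"
  shows "Ck_SPD k (\<lambda>S. f S + g S)"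
  using assms
proof (induction k arbitrary: f g)
  case 0
  then show ?case by (simp add: continuous_on_add)
next
  case (Suc k)
  have "Ck_SPD k (\<lambda>S. dir_deriv (\<lambda>S. f S + g S) S V)" if V: "V \<in> Sym" for V
  proof (rule Ck_SPD_cong)
    show "Ck_SPD k (\<lambda>S. dir_deriv f S V + dir_deriv g S V)"
      using Suc.prems V by (intro Suc.IH) auto
    fix S :: "'a mat" assume S: "S \<in> SPD"
    obtain f' g' where f: "(f has_derivative f') (at S within SPD)"
      and g: "(g has_derivative g') (at S within SPD)"
      using Suc.prems S unfolding Ck_SPD.simps differentiable_def by blast
    show "dir_deriv f S V + dir_deriv g S V = dir_deriv (\<lambda>S. f S + g S) S V"
      by (simp add: dir_deriv_eq[OF has_derivative_add[OF f g] S V] dir_deriv_eq[OF f S V]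
          dir_deriv_eq[OF g S V])
  qed
  then show ?case using Suc.prems by simp
qed

lemma Ck_SPD_bilinear:
  fixes pr :: "'a::real_normed_vector \<Rightarrow> 'b::real_normed_vector \<Rightarrow> 'c::real_normed_vector"
    and f :: "'n::finite mat \<Rightarrow> 'a" and g :: "'n mat \<Rightarrow> 'b"
  assumes "bounded_bilinear pr" and "Ck_SPD k f" "Ck_SPD k g"
  shows "Ck_SPD k (\<lambda>S. pr (f S) (g S))"
  using assms(2,3)
proof (induction k arbitrary: f g)
  case 0
  then show ?case by (simp add: bounded_bilinear.continuous_on[OF assms(1)])
next
  case (Suc k)
  have diff: "\<exists>f' g'. (f has_derivative f') (at S within SPD) \<and> (g has_derivative g') (at S within SPD)
      \<and> ((\<lambda>S. pr (f S) (g S)) has_derivative (\<lambda>h. pr (f S) (g' h) + pr (f' h) (g S))) (at S within SPD)"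
    if "S \<in> SPD" for S
  proof -
    have "f differentiable (at S within SPD)" "g differentiable (at S within SPD)"
      using Suc.prems that by (simp_all only: Ck_SPD.simps)
    then obtain f' g' where f': "(f has_derivative f') (at S within SPD)"
      and g': "(g has_derivative g') (at S within SPD)"
      unfolding differentiable_def by (elim exE)
    show ?thesis by (intro exI conjI, rule f', rule g', rule bounded_bilinear.FDERIV[OF assms(1) f' g'])
  qed
  have "Ck_SPD k (\<lambda>S. dir_deriv (\<lambda>S. pr (f S) (g S)) S V)" if V: "V \<in> Sym" for V
  proof (rule Ck_SPD_cong)
    show "Ck_SPD k (\<lambda>S. pr (f S) (dir_deriv g S V) + pr (dir_deriv f S V) (g S))"
      using Suc.prems V
      by (intro Ck_SPD_add Suc.IH Ck_SPD_Suc[OF Suc.prems(1)] Ck_SPD_Suc[OF Suc.prems(2)]) simp_all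
    fix S :: "'n mat" assume S: "S \<in> SPD"
    obtain f' g' where "(f has_derivative f') (at S within SPD)" "(g has_derivative g') (at S within SPD)"
      "((\<lambda>S. pr (f S) (g S)) has_derivative (\<lambda>h. pr (f S) (g' h) + pr (f' h) (g S))) (at S within SPD)"
      using diff[OF S] by (elim exE conjE)
    note this[THEN dir_deriv_eq, OF S V]
    then show "pr (f S) (dir_deriv g S V) + pr (dir_deriv f S V) (g S)
        = dir_deriv (\<lambda>S. pr (f S) (g S)) S V"
      by (simp only:)
  qed
  moreover have "(\<lambda>S. pr (f S) (g S)) differentiable (at S within SPD)" if "S \<in> SPD" for S
    using diff[OF that] unfolding differentiable_def by blast
  ultimately show ?case by simp
qed

lemma smooth_SPD_cong: "smooth_SPD f \<Longrightarrow> (\<And>S. S \<in> SPD \<Longrightarrow> f S = g S) \<Longrightarrow> smooth_SPD g"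
  unfolding smooth_SPD_def using Ck_SPD_cong by blast

lemma smooth_SPD_const: "smooth_SPD (\<lambda>_. c)"
  and smooth_SPD_id: "smooth_SPD (\<lambda>S. S)"
  and smooth_SPD_add: "smooth_SPD f \<Longrightarrow> smooth_SPD g \<Longrightarrow> smooth_SPD (\<lambda>S. f S + g S)"
  and smooth_SPD_bilinear: "bounded_bilinear pr \<Longrightarrow> smooth_SPD h \<Longrightarrow> smooth_SPD k \<Longrightarrow>
    smooth_SPD (\<lambda>S. pr (h S) (k S))"
  unfolding smooth_SPD_def
  by (simp_all add: Ck_SPD_const Ck_SPD_id Ck_SPD_add Ck_SPD_bilinear)

lemma smooth_SPD_dir_deriv: "smooth_SPD f \<Longrightarrow> V \<in> Sym \<Longrightarrow> smooth_SPD (\<lambda>S. dir_deriv f S V)"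
  unfolding smooth_SPD_def using Ck_SPD.simps(2) by blast

lemma smooth_SPD_sum:
  "(\<And>i. i \<in> I \<Longrightarrow> smooth_SPD (f i)) \<Longrightarrow> smooth_SPD (\<lambda>S. \<Sum>i\<in>I. f i S)"
  by (induction I rule: infinite_finite_induct) (auto intro: smooth_SPD_const smooth_SPD_add)

lemma smooth_SPD_has_derivative:
  assumes "smooth_SPD f" "S \<in> SPD"
  obtains f' where "(f has_derivative f') (at S within SPD)" "\<And>V. V \<in> Sym \<Longrightarrow> dir_deriv f S V = f' V"
proof -
  have "Ck_SPD (Suc 0) f" using assms(1) unfolding smooth_SPD_def by blast
  then obtain f' where "(f has_derivative f') (at S within SPD)"
    using assms(2) by (auto simp: differentiable_def)
  then show thesis using that dir_deriv_eq assms(2) by blast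
qed

section \<open>Gradients\<close>

definition symmetrize :: "'n::finite mat \<Rightarrow> 'n mat" where
  "symmetrize A = (1/2) *\<^sub>R (A + transpose A)"

lemma symmetrize_Sym: "symmetrize A \<in> Sym"
  by (simp add: symmetrize_def Sym_def transpose_scalar linear_simps[OF bounded_linear_transpose] add.commute)

text \<open>
  The symmetrized standard basis spans \<^const>\<open>Sym\<close> but is linearly dependent. The coefficients
  \<open>V \<bullet> b\<close> still depend linearly on \<open>V\<close>, which is all that is needed to use it as a frame of
  constant fields.
\<close>

lemma symmetrize_expansion:
  fixes V :: "'n::finite mat"
  assumes "V \<in> Sym"
  shows "V = (\<Sum>b\<in>Basis. (V \<bullet> b) *\<^sub>R symmetrize b)"
proof -
  have lin: "linear (symmetrize :: 'n mat \<Rightarrow> _)"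
    unfolding symmetrize_def
    by (intro linearI) (simp_all add: linear_simps[OF bounded_linear_transpose] algebra_simps)
  have "V = symmetrize V" using assms by (simp add: symmetrize_def SymD scaleR_2[symmetric])
  also have "\<dots> = symmetrize (\<Sum>b\<in>Basis. (V \<bullet> b) *\<^sub>R b)" by (simp add: euclidean_representation)
  also have "\<dots> = (\<Sum>b\<in>Basis. (V \<bullet> b) *\<^sub>R symmetrize b)"
    by (simp add: linear_sum[OF lin] linear_cmul[OF lin])
  finally show ?thesis .
qed

lemma gradient_wrt_eqI:
  assumes "G \<in> Sym" and "\<And>V. V \<in> Sym \<Longrightarrow> g G V = dir_deriv f S V"
    and "\<And>H. H \<in> Sym \<Longrightarrow> (\<And>V. V \<in> Sym \<Longrightarrow> g H V = g G V) \<Longrightarrow> H = G"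
  shows "gradient_wrt g f S = G"
  unfolding gradient_wrt_def
proof (rule the_equality)
  show "G \<in> Sym \<and> (\<forall>V\<in>Sym. g G V = dir_deriv f S V)" using assms(1,2) by blast
  show "H = G" if "H \<in> Sym \<and> (\<forall>V\<in>Sym. g H V = dir_deriv f S V)" for H
    using that by (intro assms(3)) (simp_all add: assms(2))
qed

lemma inner_Sym_ext:
  assumes "A \<in> Sym" "B \<in> Sym" "\<And>V. V \<in> Sym \<Longrightarrow> A \<bullet> V = B \<bullet> V"
  shows "A = B"
proof -
  have "(A - B) \<bullet> (A - B) = 0"
    using assms(3)[OF subspace_diff[OF subspace_Sym assms(1,2)]] by (simp add: inner_diff_left)
  then show ?thesis by simp
qed

text \<open>
  Any linear functional on \<^const>\<open>Sym\<close> is represented by combining the symmetrized basis with its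
  values there. The factor \<open>2\<close> compensates the \<open>1/2\<close> in \<^const>\<open>ip2\<close>. The explicit sum is what
  makes smoothness of the gradient visible.
\<close>

lemma
  fixes f :: "'n::finite mat \<Rightarrow> real"
  assumes f: "smooth_SPD f" and S: "S \<in> SPD"
  shows nabla_eq: "nabla f S = (\<Sum>b\<in>Basis. (2 * dir_deriv f S (symmetrize b)) *\<^sub>R symmetrize b)"
    and nabla_Sym: "nabla f S \<in> Sym"
    and inner_nabla: "\<And>V. V \<in> Sym \<Longrightarrow> nabla f S \<bullet> V = 2 * dir_deriv f S V"
proof -
  obtain f' where f': "(f has_derivative f') (at S within SPD)"
    "\<And>V. V \<in> Sym \<Longrightarrow> dir_deriv f S V = f' V"
    using smooth_SPD_has_derivative[OF f S] by blast
  let ?G = "\<Sum>b\<in>Basis. (2 * dir_deriv f S (symmetrize b)) *\<^sub>R symmetrize b"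
  have G: "?G \<in> Sym"
    by (intro subspace_sum[OF subspace_Sym] subspace_scale[OF subspace_Sym] symmetrize_Sym)
  have GV: "?G \<bullet> V = 2 * dir_deriv f S V" if V: "V \<in> Sym" for V
  proof -
    have "symmetrize b \<bullet> V = V \<bullet> b" for b
      using inner_transpose[of b V] by (simp add: symmetrize_def inner_add_left SymD[OF V] inner_commute[of V])
    then have "?G \<bullet> V = 2 * (\<Sum>b\<in>Basis. (V \<bullet> b) * f' (symmetrize b))"
      by (simp add: inner_sum_left f'(2) symmetrize_Sym sum_distrib_left mult_ac)
    also have "(\<Sum>b\<in>Basis. (V \<bullet> b) * f' (symmetrize b)) = f' (\<Sum>b\<in>Basis. (V \<bullet> b) *\<^sub>R symmetrize b)"
      using has_derivative_linear[OF f'(1)] by (simp add: linear_sum linear_cmul)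
    also have "\<dots> = dir_deriv f S V" using symmetrize_expansion[OF V] f'(2)[OF V] by simp
    finally show ?thesis .
  qed
  show eq: "nabla f S = ?G" unfolding nabla_def
    using G GV by (intro gradient_wrt_eqI) (auto simp: ip2_eq_inner intro!: inner_Sym_ext)
  show "nabla f S \<in> Sym" "\<And>V. V \<in> Sym \<Longrightarrow> nabla f S \<bullet> V = 2 * dir_deriv f S V"
    unfolding eq by (rule G, rule GV)
qed

lemma smooth_SPD_nabla:
  assumes "smooth_SPD f"
  shows "smooth_SPD (nabla f)"
proof (rule smooth_SPD_cong)
  show "smooth_SPD (\<lambda>S. \<Sum>b\<in>Basis. (2 * dir_deriv f S (symmetrize b)) *\<^sub>R symmetrize b)"
    by (intro smooth_SPD_sum smooth_SPD_bilinear[OF bounded_bilinear_scaleR]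
        smooth_SPD_bilinear[OF bounded_bilinear_mult] smooth_SPD_const
        smooth_SPD_dir_deriv assms symmetrize_Sym)
qed (simp add: nabla_eq[OF assms])


text \<open>
  Since \<open>wass S G V = ip2 (lyap S G) V\<close>, the two gradients are related by \<open>lyap S G = nabla f S\<close>.
\<close>

lemma riem_grad_eq:
  assumes f: "smooth_SPD f" and S: "S \<in> SPD"
  shows "riem_grad f S = nabla f S ** S + S ** nabla f S"
proof -
  let ?A = "nabla f S" and ?G = "nabla f S ** S + S ** nabla f S"
  have A: "?A \<in> Sym" by (rule nabla_Sym[OF f S])
  have G: "?G \<in> Sym" by (rule Sym_anticommutator[OF A SPD_Sym[OF S]])
  have L: "lyap S ?G = ?A" by (rule lyap_unique[OF S G refl])
  show ?thesis unfolding riem_grad_def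
  proof (rule gradient_wrt_eqI[OF G])
    show "wass S ?G V = dir_deriv f S V" if "V \<in> Sym" for V
      using wass_eq_inner[OF S G that] inner_nabla[OF f S that] by (simp add: L)
    fix H :: "'a mat" assume H: "H \<in> Sym" and eq: "\<And>V. V \<in> Sym \<Longrightarrow> wass S H V = wass S ?G V"
    have LH: "lyap S H = lyap S ?G"
      using eq by (intro inner_Sym_ext lyap_Sym S H G) (simp add: wass_eq_inner S H G)
    have "H = lyap S H ** S + S ** lyap S H" by (rule lyap_eq[OF S H, symmetric])
    also have "\<dots> = ?G" unfolding LH by (rule lyap_eq[OF S G])
    finally show "H = ?G" .
  qed
qed

lemma vector_field_const: "V \<in> Sym \<Longrightarrow> vector_field (\<lambda>_. V)"
  by (simp add: vector_field_def smooth_SPD_const)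

lemma vector_field_riem_grad:
  assumes "smooth_SPD f"
  shows "vector_field (riem_grad f)"
  unfolding vector_field_def
proof
  show "smooth_SPD (riem_grad f)"
  proof (rule smooth_SPD_cong)
    show "smooth_SPD (\<lambda>S. nabla f S ** S + S ** nabla f S)"
      by (intro smooth_SPD_add smooth_SPD_bilinear[OF bounded_bilinear_matrix_mult]
          smooth_SPD_nabla smooth_SPD_id assms)
  qed (simp add: riem_grad_eq assms)
  show "\<forall>S\<in>SPD. riem_grad f S \<in> Sym"
    by (simp add: riem_grad_eq assms Sym_anticommutator nabla_Sym SPD_Sym)
qed

lemma wass_riem_grad:
  assumes f: "smooth_SPD f" and S: "S \<in> SPD" and V: "V \<in> Sym"
  shows "wass S (riem_grad f S) V = (nabla f S \<bullet> V) / 2"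
proof -
  have G: "nabla f S ** S + S ** nabla f S \<in> Sym"
    by (rule Sym_anticommutator[OF nabla_Sym[OF f S] SPD_Sym[OF S]])
  show ?thesis unfolding riem_grad_eq[OF f S] wass_eq_inner[OF S G V]
      lyap_unique[OF S G refl] ..
qed

section \<open>Connections\<close>

lemma affine_connection_add_left:
  assumes "affine_connection D" "vector_field X" "vector_field X'" "vector_field Y" "S \<in> SPD"
  shows "D (\<lambda>S. X S + X' S) Y S = D X Y S + D X' Y S"
proof -
  have "\<forall>X X' Y. vector_field X \<longrightarrow> vector_field X' \<longrightarrow> vector_field Y \<longrightarrow>
      (\<forall>\<Sigma>\<in>SPD. D (\<lambda>S. X S + X' S) Y \<Sigma> = D X Y \<Sigma> + D X' Y \<Sigma>)"
    using assms(1) unfolding affine_connection_def by (elim conjE)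
  from this[rule_format, OF assms(2-5)] show ?thesis .
qed

lemma affine_connection_scale_left:
  assumes "affine_connection D" "smooth_SPD (f :: 'n::finite mat \<Rightarrow> real)" "vector_field X"
    "vector_field Y" "S \<in> SPD"
  shows "D (\<lambda>S. f S *\<^sub>R X S) Y S = f S *\<^sub>R D X Y S"
proof -
  have "\<forall>(f :: 'n mat \<Rightarrow> real) X Y. smooth_SPD f \<longrightarrow> vector_field X \<longrightarrow> vector_field Y \<longrightarrow>
      (\<forall>\<Sigma>\<in>SPD. D (\<lambda>S. f S *\<^sub>R X S) Y \<Sigma> = f \<Sigma> *\<^sub>R D X Y \<Sigma>)"
    using assms(1) unfolding affine_connection_def by (elim conjE)
  from this[rule_format, OF assms(2-5)] show ?thesis .
qed

lemma affine_connection_Sym: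
  assumes "affine_connection D" "vector_field X" "vector_field Y" "S \<in> SPD"
  shows "D X Y S \<in> Sym"
proof -
  have "\<forall>X Y. vector_field X \<longrightarrow> vector_field Y \<longrightarrow> vector_field (D X Y)"
    using assms(1) unfolding affine_connection_def by (elim conjE)
  then have "vector_field (D X Y)" using assms(2,3) by simp
  then show ?thesis using assms(4) by (simp add: vector_field_def)
qed

lemma metric_compatibleD:
  assumes "metric_compatible D" "vector_field X" "vector_field Y" "vector_field Z" "S \<in> SPD"
  shows "dir_deriv (\<lambda>S. wass S (Y S) (Z S)) S (X S) =
    wass S (D X Y S) (Z S) + wass S (Y S) (D X Z S)"
  using assms(1)[unfolded metric_compatible_def, rule_format, OF assms(2-5)] .

text \<open>
  Fields are total functions, and linearity over smooth functions is what removes the dependence on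
  their values off the cone: multiplication by the indicator of \<^const>\<open>SPD\<close>, which is smooth on the
  cone, erases these values without changing the connection on the cone.
\<close>

lemma affine_connection_cong:
  assumes D: "affine_connection D" and X: "vector_field X" "vector_field X'"
    and eq: "\<And>S. S \<in> SPD \<Longrightarrow> X S = X' S"
    and Y: "vector_field Y" and S: "S \<in> SPD"
  shows "D X Y S = D X' Y S"
proof -
  let ?f = "\<lambda>S. if S \<in> SPD then 1 else 0 :: real"
  have f: "smooth_SPD ?f" by (rule smooth_SPD_cong[OF smooth_SPD_const[of 1]]) simp
  note scale = affine_connection_scale_left[OF D f _ Y S]
  have "(\<lambda>S. ?f S *\<^sub>R X S) = (\<lambda>S. ?f S *\<^sub>R X' S)" using eq by auto
  then show ?thesis using scale[OF X(1)] scale[OF X(2)] S by simp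
qed

lemma affine_connection_sum:
  fixes f :: "'i \<Rightarrow> 'n::finite mat \<Rightarrow> real"
  assumes D: "affine_connection D" and Y: "vector_field Y" and S: "S \<in> SPD"
    and f: "\<And>i. i \<in> I \<Longrightarrow> smooth_SPD (f i)" and E: "\<And>i. i \<in> I \<Longrightarrow> E i \<in> Sym" and "finite I"
  shows "vector_field (\<lambda>S. \<Sum>i\<in>I. f i S *\<^sub>R E i) \<and>
    D (\<lambda>S. \<Sum>i\<in>I. f i S *\<^sub>R E i) Y S = (\<Sum>i\<in>I. f i S *\<^sub>R D (\<lambda>_. E i) Y S)"
  using \<open>finite I\<close> f E
proof (induction I)
  case empty
  have vf: "vector_field (\<lambda>_. 0 :: 'n mat)" by (rule vector_field_const[OF subspace_0[OF subspace_Sym]])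
  \<comment> \<open>The zero field is annihilated since it is zero times itself.\<close>
  have "D (\<lambda>S. (\<lambda>_. 0::real) S *\<^sub>R (\<lambda>_. 0) S) Y S = (\<lambda>_. 0::real) S *\<^sub>R D (\<lambda>_. 0) Y S"
    by (rule affine_connection_scale_left[OF D smooth_SPD_const vf Y S])
  then show ?case using vf by simp
next
  case (insert i I)
  have vE: "vector_field (\<lambda>_. E i)" and fi: "smooth_SPD (f i)"
    using insert.prems by (auto intro: vector_field_const)
  have v1: "vector_field (\<lambda>S. f i S *\<^sub>R E i)"
    using insert.prems unfolding vector_field_def
    by (auto intro!: smooth_SPD_bilinear[OF bounded_bilinear_scaleR] smooth_SPD_const subspace_scale[OF subspace_Sym])
  have IH: "vector_field (\<lambda>S. \<Sum>i\<in>I. f i S *\<^sub>R E i)"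
    "D (\<lambda>S. \<Sum>i\<in>I. f i S *\<^sub>R E i) Y S = (\<Sum>i\<in>I. f i S *\<^sub>R D (\<lambda>_. E i) Y S)"
    using insert by auto
  have "vector_field (\<lambda>S. f i S *\<^sub>R E i + (\<Sum>i\<in>I. f i S *\<^sub>R E i))"
    using v1 IH(1) unfolding vector_field_def
    by (auto intro: smooth_SPD_add subspace_add[OF subspace_Sym])
  moreover have "D (\<lambda>S. f i S *\<^sub>R E i) Y S = f i S *\<^sub>R D (\<lambda>_. E i) Y S"
    by (rule affine_connection_scale_left[OF D fi vE Y S])
  moreover have "D (\<lambda>S. f i S *\<^sub>R E i + (\<Sum>i\<in>I. f i S *\<^sub>R E i)) Y S =
      D (\<lambda>S. f i S *\<^sub>R E i) Y S + D (\<lambda>S. \<Sum>i\<in>I. f i S *\<^sub>R E i) Y S"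
    by (rule affine_connection_add_left[OF D v1 IH(1) Y S])
  ultimately show ?case by (simp only: sum.insert[OF insert.hyps] IH(2) simp_thms)
qed

text \<open>
  Tensoriality in the first argument: expansion in the global constant frame shows that only the
  value \<open>X S\<close> enters. The cone lies in a vector space, so the frame and the coordinates of \<open>X\<close>
  are defined on all of it and no localization takes place.
\<close>

lemma affine_connection_frame:
  fixes X Y :: "'n::finite field"
  assumes D: "affine_connection D" and X: "vector_field X" and Y: "vector_field Y" and S: "S \<in> SPD"
  shows "D X Y S = (\<Sum>b\<in>Basis. (X S \<bullet> b) *\<^sub>R D (\<lambda>_. symmetrize b) Y S)"
proof -
  have "smooth_SPD (\<lambda>S. X S \<bullet> b)" for b
    using X unfolding vector_field_def
    by (intro smooth_SPD_bilinear[OF bounded_bilinear_inner] smooth_SPD_const) auto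
  note * = affine_connection_sum[OF D Y S this symmetrize_Sym finite_Basis]
  have "D X Y S = D (\<lambda>S. \<Sum>b\<in>Basis. (X S \<bullet> b) *\<^sub>R symmetrize b) Y S"
    using symmetrize_expansion X unfolding vector_field_def
    by (intro affine_connection_cong[OF D X conjunct1[OF *] _ Y S]) auto
  with conjunct2[OF *] show ?thesis by simp
qed

lemma cov_deriv_at_eq:
  assumes D: "affine_connection D" and Y: "vector_field Y" and S: "S \<in> SPD" and U: "U \<in> Sym"
  shows "cov_deriv_at D S U Y = D (\<lambda>_. U) Y S"
  unfolding cov_deriv_at_def
proof (rule the_equality)
  show "\<forall>X. vector_field X \<longrightarrow> X S = U \<longrightarrow> D X Y S = D (\<lambda>_. U) Y S"
    using affine_connection_frame[OF D _ Y S] vector_field_const[OF U] by simp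
  then show "\<And>W. \<forall>X. vector_field X \<longrightarrow> X S = U \<longrightarrow> D X Y S = W \<Longrightarrow> W = D (\<lambda>_. U) Y S"
    using vector_field_const[OF U] by blast
qed

section \<open>The Levi-Civita connection on constant fields\<close>

lemma dir_deriv_wass_const:
  assumes S: "S \<in> SPD" and U: "U \<in> Sym" and V: "V \<in> Sym" and W: "W \<in> Sym"
  shows "dir_deriv (\<lambda>R. wass R V W) S U
    = - ((lyap S V ** U + U ** lyap S V) \<bullet> lyap S W) / 2"
proof -
  let ?P = "lyap S V ** U + U ** lyap S V"
  have P: "?P \<in> Sym" by (intro Sym_anticommutator lyap_Sym S V U)
  have "dir_deriv (\<lambda>R. wass R V W) S U = dir_deriv (\<lambda>R. (lyap R V \<bullet> W) / 2) S U"
    using V W by (intro dir_deriv_cong S U wass_eq_inner)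
  also have "\<dots> = (- lyap S ?P \<bullet> W) / 2"
  proof (rule dir_deriv_eqI)
    have "bounded_linear (\<lambda>X::'a mat. (X \<bullet> W) / 2)"
      by (rule bounded_linear_compose[OF bounded_linear_divide bounded_linear_inner_left])
    from bounded_linear.has_vector_derivative[OF this lyap_line_derivative[OF S U V]]
    show "((\<lambda>t. (lyap (S + t *\<^sub>R U) V \<bullet> W) / 2) has_vector_derivative
        (- lyap S ?P \<bullet> W) / 2) (at 0)" .
  qed
  finally show ?thesis by (simp add: lyap_self_adjoint[OF S P W])
qed

text \<open>
  Koszul's formula for two constant fields. The brackets vanish, so \<open>D V Z = D Z V\<close>, and metric
  compatibility for the triples \<open>(V, V, Z)\<close> and \<open>(Z, V, V)\<close> determines \<open>D V V\<close>.
\<close>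

lemma koszul_const:
  assumes D: "levi_civita D" and S: "S \<in> SPD" and V: "V \<in> Sym" and Z: "Z \<in> Sym"
  shows "wass S (D (\<lambda>_. V) (\<lambda>_. V) S) Z
    = dir_deriv (\<lambda>R. wass R V Z) S V - dir_deriv (\<lambda>R. wass R V V) S Z / 2"
proof -
  have vf: "vector_field (\<lambda>_. V)" "vector_field (\<lambda>_. Z)" using V Z by (auto intro: vector_field_const)
  have aff: "affine_connection D" and tf: "torsion_free D" and mc: "metric_compatible D"
    using D by (simp_all add: levi_civita_def)
  have DSym: "D X Y S \<in> Sym" if "vector_field X" "vector_field Y" for X Y
    by (rule affine_connection_Sym[OF aff that S])
  have compat: "dir_deriv (\<lambda>R. wass R (B R) (C R)) S (A S) =
      wass S (D A B S) (C S) + wass S (B S) (D A C S)"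
    if "vector_field A" "vector_field B" "vector_field C" for A B C
    by (rule metric_compatibleD[OF mc that S])
  have "D (\<lambda>_. V) (\<lambda>_. Z) S - D (\<lambda>_. Z) (\<lambda>_. V) S = lie_bracket (\<lambda>_. V) (\<lambda>_. Z) S"
    using tf vf S by (simp add: torsion_free_def)
  then have sym: "D (\<lambda>_. V) (\<lambda>_. Z) S = D (\<lambda>_. Z) (\<lambda>_. V) S" by (simp add: lie_bracket_def)
  have "wass S (D (\<lambda>_. Z) (\<lambda>_. V) S) V = wass S V (D (\<lambda>_. Z) (\<lambda>_. V) S)"
    by (intro wass_commute S DSym vf V)
  then show ?thesis
    using compat[OF vf(1) vf(1) vf(2)] compat[OF vf(2) vf(1) vf(1)] sym by simp
qed

text \<open>
  The Christoffel term, paired with \<open>A ** S + S ** A\<close>, the direction whose Lyapunov solution is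
  \<open>A\<close>. Expanding \<open>V = L S + S L\<close> in the two derivatives of the metric gives the traces of \<open>A L L S\<close>
  and \<open>A S L L\<close>, which agree by transposition and cancel; only the trace of \<open>A L S L\<close> survives.
\<close>

lemma wass_christoffel:
  fixes A :: "'n::finite mat"
  assumes D: "levi_civita D" and S: "S \<in> SPD" and V: "V \<in> Sym" and A: "A \<in> Sym"
  shows "wass S (D (\<lambda>_. V) (\<lambda>_. V) S) (A ** S + S ** A) = - (A \<bullet> (lyap S V ** S ** lyap S V))"
proof -
  define L where "L = lyap S V"
  let ?Z = "A ** S + S ** A"
  have L: "L \<in> Sym" unfolding L_def by (rule lyap_Sym[OF S V])
  have Z: "?Z \<in> Sym" by (rule Sym_anticommutator[OF A SPD_Sym[OF S]])
  have tr: "transpose A = A" "transpose S = S" "transpose L = L" by (simp_all add: SymD A L SPD_Sym S)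
  have LZ: "lyap S ?Z = A" by (rule lyap_unique[OF S Z refl])
  have Veq: "V = L ** S + S ** L" unfolding L_def by (rule lyap_eq[OF S V, symmetric])
  define p where "p = A \<bullet> (L ** L ** S)"
  have p: "A \<bullet> (S ** L ** L) = p"
    using inner_transpose[of A "L ** L ** S"] by (simp add: p_def matrix_transpose_mul tr matrix_mul_assoc)
  have "(L ** V + V ** L) \<bullet> A = 2 * p + 2 * (A \<bullet> (L ** S ** L))"
    unfolding Veq inner_commute[of _ A]
    by (simp only: matrix_mult_simps inner_add_right p p_def[symmetric])
  moreover have "(L ** ?Z + ?Z ** L) \<bullet> L = 4 * p"
  proof -
    have "(L ** ?Z + ?Z ** L) \<bullet> L = 2 * (?Z \<bullet> (L ** L))"
      by (simp only: inner_add_left inner_matrix_mult_left[of L ?Z] inner_matrix_mult_right[of ?Z L] tr mult_2)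
    also have "?Z \<bullet> (L ** L) = A \<bullet> (L ** L ** S) + A \<bullet> (S ** L ** L)"
      by (simp only: inner_add_left inner_matrix_mult_left[of S A] inner_matrix_mult_right[of A S] tr matrix_mul_assoc)
    finally show ?thesis by (simp add: p p_def[symmetric])
  qed
  ultimately show ?thesis
    unfolding koszul_const[OF D S V Z] dir_deriv_wass_const[OF S V V Z]
      dir_deriv_wass_const[OF S Z V V] LZ L_def[symmetric] by (simp add: diff_divide_distrib)
qed

section \<open>The Riemannian Hessian\<close>

theorem mainTheorem8:
  fixes D :: "'n::finite field \<Rightarrow> 'n field \<Rightarrow> 'n field"
    and \<phi> :: "'n mat \<Rightarrow> real"
    and \<Sigma> V :: "'n mat"
  assumes "levi_civita D"
    and "smooth_SPD \<phi>"
    and "\<Sigma> \<in> SPD"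
    and "V \<in> Sym"
  shows "riem_hess D \<phi> \<Sigma> V V =
      wass \<Sigma> (nabla2 \<phi> \<Sigma> V ** \<Sigma> + \<Sigma> ** nabla2 \<phi> \<Sigma> V) V
      + trace (nabla \<phi> \<Sigma> ** lyap \<Sigma> V ** \<Sigma> ** lyap \<Sigma> V)"
proof -
  note D = assms(1) and f = assms(2) and S = assms(3) and V = assms(4)
  let ?A = "nabla \<phi> \<Sigma>" and ?H = "nabla2 \<phi> \<Sigma> V" and ?G = "riem_grad \<phi>" and ?V = "\<lambda>_::'n mat. V"
  have aff: "affine_connection D" and mc: "metric_compatible D" using D by (auto simp: levi_civita_def)
  have vG: "vector_field ?G" and vV: "vector_field ?V"
    using vector_field_riem_grad[OF f] vector_field_const[OF V] by auto
  have DSym: "D ?V ?V \<Sigma> \<in> Sym"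
    by (rule affine_connection_Sym[OF aff vV vV S])
  have A: "?A \<in> Sym" by (rule nabla_Sym[OF f S])
  have deriv: "((\<lambda>t. nabla \<phi> (\<Sigma> + t *\<^sub>R V)) has_vector_derivative ?H) (at 0)"
  proof -
    obtain n' where n': "(nabla \<phi> has_derivative n') (at \<Sigma> within SPD)"
      using smooth_SPD_has_derivative[OF smooth_SPD_nabla[OF f] S] by blast
    show ?thesis unfolding nabla2_def dir_deriv_eq[OF n' S V]
      by (rule line_vector_derivative[OF n' S V])
  qed
  \<comment> \<open>Transposition commutes with the derivative and fixes the gradient along the segment.\<close>
  have H: "?H \<in> Sym"
  proof -
    have "dir_deriv (\<lambda>R. transpose (nabla \<phi> R)) \<Sigma> V = transpose ?H"
      by (rule dir_deriv_eqI[OF bounded_linear.has_vector_derivative[OF bounded_linear_transpose deriv]])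
    moreover have "dir_deriv (\<lambda>R. transpose (nabla \<phi> R)) \<Sigma> V = ?H"
      unfolding nabla2_def by (intro dir_deriv_cong S V SymD nabla_Sym f)
    ultimately show ?thesis by (simp add: Sym_def)
  qed
  have HS: "?H ** \<Sigma> + \<Sigma> ** ?H \<in> Sym" by (rule Sym_anticommutator[OF H SPD_Sym[OF S]])
  \<comment> \<open>Metric compatibility trades the covariant derivative of the gradient for that of the constant field.\<close>
  have "dir_deriv (\<lambda>R. wass R (?G R) (?V R)) \<Sigma> (?V \<Sigma>)
      = wass \<Sigma> (D ?V ?G \<Sigma>) (?V \<Sigma>) + wass \<Sigma> (?G \<Sigma>) (D ?V ?V \<Sigma>)"
    by (rule metric_compatibleD[OF mc vV vG vV S])
  moreover have "dir_deriv (\<lambda>R. wass R (?G R) V) \<Sigma> V = wass \<Sigma> (?H ** \<Sigma> + \<Sigma> ** ?H) V"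
  proof -
    have "dir_deriv (\<lambda>R. wass R (?G R) V) \<Sigma> V = dir_deriv (\<lambda>R. (nabla \<phi> R \<bullet> V) / 2) \<Sigma> V"
      by (intro dir_deriv_cong S V wass_riem_grad f)
    also have "\<dots> = (?H \<bullet> V) / 2"
    proof (rule dir_deriv_eqI)
      have "bounded_linear (\<lambda>X::'n mat. (X \<bullet> V) / 2)" by (rule bounded_linear_compose[OF bounded_linear_divide bounded_linear_inner_left])
      from bounded_linear.has_vector_derivative[OF this deriv]
      show "((\<lambda>t. (nabla \<phi> (\<Sigma> + t *\<^sub>R V) \<bullet> V) / 2) has_vector_derivative (?H \<bullet> V) / 2) (at 0)" .
    qed
    also have "\<dots> = wass \<Sigma> (?H ** \<Sigma> + \<Sigma> ** ?H) V"
      unfolding wass_eq_inner[OF S HS V] lyap_unique[OF S HS refl] ..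
    finally show ?thesis .
  qed
  moreover have "wass \<Sigma> (?G \<Sigma>) (D ?V ?V \<Sigma>) = - trace (?A ** lyap \<Sigma> V ** \<Sigma> ** lyap \<Sigma> V)"
  proof -
    have "wass \<Sigma> (?G \<Sigma>) (D ?V ?V \<Sigma>) = wass \<Sigma> (D ?V ?V \<Sigma>) (?A ** \<Sigma> + \<Sigma> ** ?A)"
      unfolding riem_grad_eq[OF f S]
      by (rule wass_commute[OF S Sym_anticommutator[OF A SPD_Sym[OF S]] DSym])
    also have "\<dots> = - (?A \<bullet> (lyap \<Sigma> V ** \<Sigma> ** lyap \<Sigma> V))"
      by (rule wass_christoffel[OF D S V A])
    finally show ?thesis by (simp add: inner_matrix_eq_trace SymD[OF A] matrix_mul_assoc)
  qed
  moreover have "riem_hess D \<phi> \<Sigma> V V = wass \<Sigma> (D ?V ?G \<Sigma>) V"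
    unfolding riem_hess_def cov_deriv_at_eq[OF aff vG S V] ..
  ultimately show ?thesis by simp
qed

end
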